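(* Let $(\boldsymbol X_1,Y_1),\ldots,(\boldsymbol X_n,Y_n)$ be i.i.d. copies of a random pair $(\boldsymbol X,Y)\in\mathbb R^d\times\mathbb R$ following the regression model $Y=\varphi(\boldsymbol X)+\varepsilon$ with $\mathbb E(\varepsilon\mid\boldsymbol X)=0$ and $\mathbb E(\varepsilon^2\mid\boldsymbol X)<\infty$ almost surely. Let $$\mathcal Q:=\{(\psi(\boldsymbol X_1),\ldots,\psi(\boldsymbol X_n)):\ \psi:\mathbb R^d\to\mathbb R \text{ quasiconvex and decreasing}\}\subseteq\mathbb R^n .$$ Then the optimization problem $\min_{\boldsymbol\theta\in\mathcal Q}\sum_{k=1}^n(Y_k-\theta_k)^2$ has a minimizer $\widehat{\boldsymbol\theta}\in\mathcal Q$. Moreover, if $Y$ has a density with respect to the Lebesgue measure on $\mathbb R$, then the minimizer $\widehat{\boldsymbol\theta}$ is unique with probability $1$.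
   Context: For $\boldsymbol a,\boldsymbol b\in\mathbb R^d$, $\boldsymbol a\le\boldsymbol b$ means $a_i\le b_i$ for all $i$. $\psi:\mathbb R^d\to\mathbb R$ is quasiconvex if $\psi(\lambda\boldsymbol x+(1-\lambda)\boldsymbol y)\le\max\{\psi(\boldsymbol x),\psi(\boldsymbol y)\}$ for all $\boldsymbol x,\boldsymbol y\in\mathbb R^d$, $\lambda\in[0,1]$, and decreasing if $\psi(\boldsymbol x)\ge\psi(\boldsymbol y)$ whenever $\boldsymbol x\le\boldsymbol y$. *)

theory Defs
  imports "HOL-Probability.Probability"
begin

definition quasiconvex :: "('a::real_vector \<Rightarrow> real) \<Rightarrow> bool" where
  "quasiconvex \<psi> \<longleftrightarrow>
     (\<forall>x y. \<forall>t\<in>{0..1}. \<psi> (t *\<^sub>R x + (1 - t) *\<^sub>R y) \<le> max (\<psi> x) (\<psi> y))"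

(* The order on vectors is the componentwise one, so antimono is "decreasing". *)
definition fit_set :: "('n::finite \<Rightarrow> real ^ 'd) \<Rightarrow> (real ^ 'n) set" where
  "fit_set x = {\<chi> k. \<psi> (x k) | \<psi>. quasiconvex \<psi> \<and> antimono \<psi>}"

definition least_squares_fit ::
    "('n::finite \<Rightarrow> real ^ 'd) \<Rightarrow> ('n \<Rightarrow> real) \<Rightarrow> real ^ 'n \<Rightarrow> bool" where
  "least_squares_fit x y \<theta> \<longleftrightarrow>
     is_arg_min (\<lambda>\<theta>. \<Sum>k\<in>UNIV. (y k - \<theta> $ k)\<^sup>2) (\<lambda>\<theta>. \<theta> \<in> fit_set x) \<theta>"

(* No integrability of \<epsilon> is required: when E(\<epsilon>^2 | X) is finite a.s., both
   E(\<epsilon>^+ | X) and E(\<epsilon>^- | X) are finite a.s., and real_cond_exp is their difference. *)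
definition regression_model ::
    "'a measure \<Rightarrow> ('a \<Rightarrow> real ^ 'd) \<Rightarrow> ('a \<Rightarrow> real) \<Rightarrow> (real ^ 'd \<Rightarrow> real) \<Rightarrow> ('a \<Rightarrow> real) \<Rightarrow> bool" where
  "regression_model M X Y \<phi> \<epsilon> \<longleftrightarrow>
     X \<in> borel_measurable M \<and> Y \<in> borel_measurable M \<and> \<epsilon> \<in> borel_measurable M \<and>
     (AE \<omega> in M. Y \<omega> = \<phi> (X \<omega>) + \<epsilon> \<omega>) \<and>
     (AE \<omega> in M. real_cond_exp M (vimage_algebra (space M) X borel) \<epsilon> \<omega> = 0) \<and>
     (AE \<omega> in M. nn_cond_exp M (vimage_algebra (space M) X borel)
                    (\<lambda>\<omega>. ennreal ((\<epsilon> \<omega>)\<^sup>2)) \<omega> < \<infinity>)"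

definition iid_copies :: "'a measure \<Rightarrow> ('n \<Rightarrow> 'a \<Rightarrow> 'b::topological_space) \<Rightarrow> ('a \<Rightarrow> 'b) \<Rightarrow> bool" where
  "iid_copies M Zs Z \<longleftrightarrow>
     prob_space.indep_vars M (\<lambda>_. borel) Zs UNIV \<and>
     (\<forall>k. distr M borel (Zs k) = distr M borel Z)"

end

theory Submission
  imports Defs
begin

text \<open>
  Membership in the feasible set depends only on the order pattern of \<open>\<theta>\<close>: if \<open>x k\<close> lies above
  a point of the convex hull of the \<open>x j\<close> with \<open>j \<in> S\<close>, then \<open>\<theta> k\<close> is at most the maximum of
  \<open>\<theta>\<close> over \<open>S\<close>. So the feasible set is closed, which gives existence. By stationarity along
  perturbations that respect the order pattern, a minimizer is constant on blocks of indices, with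
  value the block mean of \<open>y\<close>; it is \<open>A y\<close> for one of finitely many symmetric averaging matrices
  \<open>A\<close>, and the minimal value is \<open>|y|\<^sup>2 - y \<bullet> A y\<close>. Two distinct minimizers therefore make \<open>y\<close> a
  zero, with nonzero gradient, of the quadratic form of a difference of two such matrices. Moving
  one coordinate of \<open>y\<close> along which the gradient does not vanish meets such zeros only finitely
  often, so they are null for a product of atomless laws. Only the law of the responses enters: the
  feasible set depends on the design points, but the set of averaging matrices does not.
\<close>

section \<open>Order description of the feasible set\<close>

definition dominates :: "('n \<Rightarrow> real ^ 'd) \<Rightarrow> 'n set \<Rightarrow> 'n \<Rightarrow> bool" where
  "dominates x S k \<longleftrightarrow> (\<exists>u\<in>convex hull (x ` S). u \<le> x k)"

lemma convex_combination_mono: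
  fixes u v x y :: "real ^ 'd"
  assumes "u \<le> x" "v \<le> y" "0 \<le> t" "t \<le> 1"
  shows "t *\<^sub>R u + (1 - t) *\<^sub>R v \<le> t *\<^sub>R x + (1 - t) *\<^sub>R y"
  using assms by (auto simp: less_eq_vec_def intro!: add_mono mult_left_mono)

text \<open>Sublevel sets of \<open>\<psi>\<close> are convex, so a bound over \<open>S\<close>
  extends to the hull; monotonicity then carries it from \<open>u\<close> up to
  \<open>x k\<close>.\<close>

lemma fit_set_dominates:
  fixes x :: "'n::finite \<Rightarrow> real ^ 'd"
  assumes "\<theta> \<in> fit_set x" "dominates x S k"
  shows "\<exists>j\<in>S. \<theta> $ k \<le> \<theta> $ j"
proof -
  obtain \<psi> where \<psi>: "quasiconvex \<psi>" "antimono \<psi>" "\<theta> = (\<chi> k. \<psi> (x k))"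
    using assms(1) by (auto simp: fit_set_def)
  obtain u where u: "u \<in> convex hull (x ` S)" "u \<le> x k"
    using assms(2) by (auto simp: dominates_def)
  define c where "c = Max (\<psi> ` x ` S)"
  have ne: "S \<noteq> {}" using u by auto
  have "convex {z. \<psi> z \<le> c}"
    unfolding convex_def
  proof (clarify)
    fix z w and s t :: real
    assume *: "\<psi> z \<le> c" "\<psi> w \<le> c" "0 \<le> s" "0 \<le> t" "s + t = 1"
    then have "s \<in> {0..1}" "t = 1 - s" by auto
    then have "\<psi> (s *\<^sub>R z + t *\<^sub>R w) \<le> max (\<psi> z) (\<psi> w)"
      using \<psi>(1) unfolding quasiconvex_def by metis
    then show "\<psi> (s *\<^sub>R z + t *\<^sub>R w) \<le> c" using * by simp
  qed
  moreover have "x ` S \<subseteq> {z. \<psi> z \<le> c}" by (auto simp: c_def)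
  ultimately have "\<psi> u \<le> c" using u(1) hull_minimal[of "x ` S" "{z. \<psi> z \<le> c}" convex] by blast
  moreover have "\<psi> (x k) \<le> \<psi> u" using \<psi>(2) u(2) by (rule antimonoD)
  moreover have "c \<in> \<psi> ` x ` S" unfolding c_def by (rule Max_in) (use ne in auto)
  then obtain j where "j \<in> S" "c = \<psi> (x j)" by auto
  ultimately show ?thesis using \<psi>(3) by (intro bexI[of _ j]) auto
qed

text \<open>The witness \<open>\<psi>\<close> sends \<open>z\<close> to the least value \<alpha> of
  \<open>\<theta>\<close> such that \<open>z\<close> lies above the hull of the data points of value
  at most \<alpha>. Its sublevel sets are convex and upward closed.\<close>

lemma in_fit_setI:
  fixes x :: "'n::finite \<Rightarrow> real ^ 'd"
  assumes "\<And>k S. dominates x S k \<Longrightarrow> \<exists>j\<in>S. \<theta> $ k \<le> \<theta> $ j"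
  shows "\<theta> \<in> fit_set x"
proof -
  define c where "c = Max (range (($) \<theta>))"
  define L where "L \<alpha> = {z. \<exists>u\<in>convex hull (x ` {j. \<theta> $ j \<le> \<alpha>}). u \<le> z}" for \<alpha>
  \<comment> \<open>Inserting the largest value \<open>c\<close> keeps \<open>Min\<close> meaningful
    at points outside every \<open>L \<alpha>\<close>.\<close>
  define V where "V z = insert c {\<alpha> \<in> range (($) \<theta>). z \<in> L \<alpha>}" for z
  define \<psi> where "\<psi> z = Min (V z)" for z
  have finV: "finite (V z)" for z by (simp add: V_def)
  have \<psi>_in: "\<psi> z = c \<or> \<psi> z \<in> range (($) \<theta>) \<and> z \<in> L (\<psi> z)" for z
    using Min_in[of "V z"] finV[of z] unfolding \<psi>_def[symmetric] by (auto simp: V_def)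
  have \<psi>_le: "\<psi> z \<le> \<alpha>" if "\<alpha> = c \<or> \<alpha> \<in> range (($) \<theta>) \<and> z \<in> L \<alpha>" for z \<alpha>
    unfolding \<psi>_def by (rule Min_le[OF finV]) (use that in \<open>auto simp: V_def\<close>)
  have le_c: "\<theta> $ j \<le> c" for j by (simp add: c_def)
  have \<psi>_c: "\<psi> z \<le> c" for z by (rule \<psi>_le) simp
  have L_mono: "L \<alpha> \<subseteq> L \<beta>" if "\<alpha> \<le> \<beta>" for \<alpha> \<beta>
  proof -
    have "x ` {j. \<theta> $ j \<le> \<alpha>} \<subseteq> x ` {j. \<theta> $ j \<le> \<beta>}" using that by auto
    from hull_mono[OF this, of convex] show ?thesis by (auto simp: L_def)
  qed
  have "quasiconvex \<psi>"
    unfolding quasiconvex_def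
  proof (intro allI ballI)
    fix z w and t :: real
    assume t: "t \<in> {0..1}"
    define \<alpha> where "\<alpha> = max (\<psi> z) (\<psi> w)"
    show "\<psi> (t *\<^sub>R z + (1 - t) *\<^sub>R w) \<le> \<alpha>"
    proof (cases "\<alpha> = c")
      case True
      then show ?thesis using \<psi>_c by simp
    next
      case False
      then have "\<psi> z \<noteq> c" "\<psi> w \<noteq> c"
        using \<psi>_c[of z] \<psi>_c[of w] by (auto simp: \<alpha>_def max_def split: if_splits)
      then have "\<alpha> \<in> range (($) \<theta>)" "z \<in> L (\<psi> z)" "w \<in> L (\<psi> w)"
        using \<psi>_in[of z] \<psi>_in[of w] by (auto simp: \<alpha>_def max_def)
      moreover have "\<psi> z \<le> \<alpha>" "\<psi> w \<le> \<alpha>" by (auto simp: \<alpha>_def)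
      ultimately have "z \<in> L \<alpha>" "w \<in> L \<alpha>" using L_mono by blast+
      then obtain u v where uv: "u \<in> convex hull (x ` {j. \<theta> $ j \<le> \<alpha>})" "u \<le> z"
        "v \<in> convex hull (x ` {j. \<theta> $ j \<le> \<alpha>})" "v \<le> w"
        by (auto simp: L_def)
      have "t *\<^sub>R u + (1 - t) *\<^sub>R v \<in> convex hull (x ` {j. \<theta> $ j \<le> \<alpha>})"
        using t uv by (intro convexD[OF convex_convex_hull]) auto
      moreover have "t *\<^sub>R u + (1 - t) *\<^sub>R v \<le> t *\<^sub>R z + (1 - t) *\<^sub>R w"
        using t uv by (intro convex_combination_mono) auto
      ultimately have "t *\<^sub>R z + (1 - t) *\<^sub>R w \<in> L \<alpha>" by (auto simp: L_def)
      then show ?thesis using \<open>\<alpha> \<in> range (($) \<theta>)\<close> by (intro \<psi>_le) auto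
    qed
  qed
  moreover have "antimono \<psi>"
  proof (rule antimonoI)
    fix z w :: "real ^ 'd"
    assume "z \<le> w"
    then have "z \<in> L \<alpha> \<Longrightarrow> w \<in> L \<alpha>" for \<alpha> unfolding L_def by (auto intro: order_trans)
    then show "\<psi> w \<le> \<psi> z" using \<psi>_in[of z] by (intro \<psi>_le) auto
  qed
  moreover have "\<theta> = (\<chi> k. \<psi> (x k))"
  proof (rule vec_eq_iff[THEN iffD2], intro allI, simp, rule antisym)
    fix k
    show "\<theta> $ k \<le> \<psi> (x k)"
    proof (cases "\<psi> (x k) = c")
      case False
      then have "x k \<in> L (\<psi> (x k))" using \<psi>_in by blast
      \<comment> \<open>The dominating set is a sublevel block, so the \<open>j\<close> supplied by
        the hypothesis has \<open>\<theta> $ j \<le> \<psi> (x k)\<close>.\<close>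
      then have "dominates x {j. \<theta> $ j \<le> \<psi> (x k)} k" by (auto simp: L_def dominates_def)
      then show ?thesis using assms by fastforce
    qed (simp add: le_c)
    have "x k \<in> convex hull (x ` {j. \<theta> $ j \<le> \<theta> $ k})" by (intro hull_inc) auto
    then show "\<psi> (x k) \<le> \<theta> $ k" by (intro \<psi>_le) (auto simp: L_def)
  qed
  ultimately show ?thesis unfolding fit_set_def by blast
qed

text \<open>The domination conditions only compare coordinates, so they survive every change of
  values that respects order and ties.\<close>

lemma fit_set_order_invariant:
  assumes "\<theta> \<in> fit_set x" "\<And>j k. \<theta> $ j \<le> \<theta> $ k \<Longrightarrow> \<eta> $ j \<le> \<eta> $ k"
  shows "\<eta> \<in> fit_set x"
  using fit_set_dominates[OF assms(1)] assms(2) by (intro in_fit_setI) blast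

lemma fit_set_nonempty: "fit_set x \<noteq> {}"
proof -
  have "quasiconvex (\<lambda>_. 0)" "antimono (\<lambda>_. 0::real)"
    by (auto simp: quasiconvex_def intro: antimonoI)
  then show ?thesis unfolding fit_set_def by blast
qed

text \<open>Each domination condition is a finite union of closed half-spaces.\<close>

lemma closed_fit_set:
  fixes x :: "'n::finite \<Rightarrow> real ^ 'd"
  shows "closed (fit_set x)"
proof -
  have "fit_set x = (\<Inter>(k, S)\<in>{(k, S). dominates x S k}. \<Union>j\<in>S. {\<theta>. \<theta> $ k \<le> \<theta> $ j})"
    using fit_set_dominates in_fit_setI by fastforce
  moreover have "closed {\<theta> :: real ^ 'n. \<theta> $ k \<le> \<theta> $ j}" for k j
    by (intro closed_Collect_le continuous_intros)
  ultimately show ?thesis by (auto intro!: closed_INT closed_UN)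
qed

text \<open>The objective is a squared Euclidean distance, so a nearest point is a minimizer. The
  feasible set need not be convex, so uniqueness requires a separate argument.\<close>

lemma least_squares_fit_exists:
  fixes x :: "'n::finite \<Rightarrow> real ^ 'd"
  shows "\<exists>\<theta>. least_squares_fit x y \<theta>"
proof -
  obtain \<theta> where \<theta>: "\<theta> \<in> fit_set x" "\<And>\<eta>. \<eta> \<in> fit_set x \<Longrightarrow> dist (\<chi> k. y k) \<theta> \<le> dist (\<chi> k. y k) \<eta>"
    using distance_attains_inf[OF closed_fit_set fit_set_nonempty] by metis
  have "(\<Sum>k\<in>UNIV. (y k - \<eta> $ k)\<^sup>2) = (dist (\<chi> k. y k) \<eta>)\<^sup>2" for \<eta>
    by (simp add: dist_norm norm_vec_def L2_set_def sum_nonneg)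
  then have "least_squares_fit x y \<theta>"
    using \<theta> by (auto simp: least_squares_fit_def is_arg_min_def not_less intro!: power_mono)
  then show ?thesis ..
qed

section \<open>Stationarity and block averages\<close>

text \<open>For small \<open>s\<close> of either sign the perturbation \<open>\<theta> + s *\<^sub>R g(\<theta>)\<close> has the same order pattern
  as \<open>\<theta>\<close>, hence stays feasible, so the objective is stationary in this direction.\<close>

lemma least_squares_fit_stationary:
  fixes x :: "'n::finite \<Rightarrow> real ^ 'd"
  assumes "least_squares_fit x y \<theta>"
  shows "(\<Sum>k\<in>UNIV. g (\<theta> $ k) * (y k - \<theta> $ k)) = 0"
proof -
  define \<eta> where "\<eta> s = (\<chi> k. \<theta> $ k + s * g (\<theta> $ k))" for s
  define f where "f s = (\<Sum>k\<in>UNIV. (y k - (\<theta> $ k + s * g (\<theta> $ k)))\<^sup>2)" for s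
  have "\<forall>\<^sub>F s in nhds 0. \<theta> $ j < \<theta> $ k \<longrightarrow> \<eta> s $ j < \<eta> s $ k" for j k
  proof (cases "\<theta> $ j < \<theta> $ k")
    case True
    have "((\<lambda>s. (\<theta> $ k + s * g (\<theta> $ k)) - (\<theta> $ j + s * g (\<theta> $ j))) \<longlongrightarrow>
        (\<theta> $ k + 0 * g (\<theta> $ k)) - (\<theta> $ j + 0 * g (\<theta> $ j))) (nhds 0)"
      by (intro tendsto_intros) (simp_all add: filterlim_ident)
    from order_tendstoD(1)[OF this, of 0] True show ?thesis
      by (auto simp: \<eta>_def elim: eventually_mono)
  qed simp
  then have "\<forall>\<^sub>F s in nhds 0. \<forall>j k. \<theta> $ j < \<theta> $ k \<longrightarrow> \<eta> s $ j < \<eta> s $ k"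
    by (intro eventually_all_finite)
  then have "\<forall>\<^sub>F s in nhds 0. f 0 \<le> f s"
  proof eventually_elim
    case (elim s)
    \<comment> \<open>Ties survive because the perturbation depends on the index only through the
      value of \<open>\<theta>\<close>.\<close>
    have "\<eta> s $ j \<le> \<eta> s $ k" if "\<theta> $ j \<le> \<theta> $ k" for j k
      using elim that by (cases "\<theta> $ j = \<theta> $ k") (auto simp: \<eta>_def less_le)
    then have "\<eta> s \<in> fit_set x"
      using assms fit_set_order_invariant[of \<theta> x "\<eta> s"]
      by (auto simp: least_squares_fit_def is_arg_min_def)
    then show ?case
      using assms by (auto simp: least_squares_fit_def is_arg_min_def not_less \<eta>_def f_def)
  qed
  then obtain d where d: "d > 0" "\<forall>s. \<bar>0 - s\<bar> < d \<longrightarrow> f 0 \<le> f s"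
    unfolding eventually_nhds_metric by (auto simp: dist_real_def)
  have "(f has_real_derivative - 2 * (\<Sum>k\<in>UNIV. g (\<theta> $ k) * (y k - \<theta> $ k))) (at 0)"
    unfolding f_def
    by (auto intro!: derivative_eq_intros sum.cong simp: sum_distrib_left algebra_simps)
  from DERIV_local_min[OF this d] show ?thesis by simp
qed

text \<open>For an equivalence \<open>r\<close> this is the orthogonal projection onto vectors
  constant on its classes. Indexing by relations on a finite type leaves finitely many
  matrices.\<close>

definition average_matrix :: "('n \<Rightarrow> 'n \<Rightarrow> bool) \<Rightarrow> 'n \<Rightarrow> 'n \<Rightarrow> real" where
  "average_matrix r k j = of_bool (r k j) / card {l. r k l}"

lemma average_matrix_sym:
  assumes "equivp r"
  shows "average_matrix r k j = average_matrix r j k"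
proof -
  have "r k j = r j k" using assms by (metis equivp_symp)
  moreover have "r k = r j" if "r k j" using assms that by (simp add: equivp_def)
  ultimately show ?thesis by (auto simp: average_matrix_def)
qed

text \<open>With \<open>g\<close> the indicator of the value \<open>\<theta> $ k\<close>,
  stationarity makes the residuals sum to zero over that level block.\<close>

lemma least_squares_fit_average:
  fixes x :: "'n::finite \<Rightarrow> real ^ 'd"
  assumes "least_squares_fit x y \<theta>"
  shows "\<theta> $ k = (\<Sum>j\<in>UNIV. average_matrix (\<lambda>k j. \<theta> $ k = \<theta> $ j) k j * y j)"
proof -
  let ?B = "{j. \<theta> $ k = \<theta> $ j}"
  have "0 = (\<Sum>j\<in>UNIV. of_bool (\<theta> $ k = \<theta> $ j) * (y j - \<theta> $ j))"
    using least_squares_fit_stationary[OF assms, of "\<lambda>v. of_bool (\<theta> $ k = v)"] by simp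
  also have "\<dots> = (\<Sum>j\<in>?B. y j - \<theta> $ k)"
    by (rule sum.mono_neutral_cong_right) auto
  finally have "card ?B * \<theta> $ k = sum y ?B"
    unfolding sum_subtractf sum_constant by simp
  moreover have "card ?B > 0" by (auto simp: card_gt_0_iff)
  ultimately have "\<theta> $ k = sum y ?B / card ?B"
    by (metis nonzero_mult_div_cancel_left of_nat_0_less_iff less_irrefl)
  also have "\<dots> = (\<Sum>j\<in>?B. y j / card ?B)" by (simp add: sum_divide_distrib)
  also have "\<dots> = (\<Sum>j\<in>UNIV. average_matrix (\<lambda>k j. \<theta> $ k = \<theta> $ j) k j * y j)"
    by (rule sum.mono_neutral_cong_left) (auto simp: average_matrix_def)
  finally show ?thesis .
qed

text \<open>Pythagoras: with \<open>g\<close> the identity, stationarity makes the residual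
  orthogonal to \<open>\<theta>\<close>.\<close>

lemma least_squares_fit_value:
  fixes x :: "'n::finite \<Rightarrow> real ^ 'd"
  assumes "least_squares_fit x y \<theta>"
  shows "(\<Sum>k\<in>UNIV. (y k - \<theta> $ k)\<^sup>2) = (\<Sum>k\<in>UNIV. (y k)\<^sup>2) - (\<Sum>k\<in>UNIV. y k * \<theta> $ k)"
proof -
  have "(\<Sum>k\<in>UNIV. (y k - \<theta> $ k)\<^sup>2) =
      (\<Sum>k\<in>UNIV. (y k)\<^sup>2) - (\<Sum>k\<in>UNIV. y k * \<theta> $ k) - (\<Sum>k\<in>UNIV. \<theta> $ k * (y k - \<theta> $ k))"
    unfolding sum_subtractf[symmetric]
    by (rule sum.cong) (auto simp: power2_eq_square algebra_simps)
  then show ?thesis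
    using least_squares_fit_stationary[OF assms, of "\<lambda>v. v"] by simp
qed

text \<open>For symmetric \<open>C\<close> the sum required to be nonzero is half the partial
  derivative of the form in coordinate \<open>i\<close>.\<close>

definition critical_zeros :: "('n::finite \<Rightarrow> 'n \<Rightarrow> real) \<Rightarrow> 'n \<Rightarrow> ('n \<Rightarrow> real) set" where
  "critical_zeros C i =
     {y. (\<Sum>k\<in>UNIV. \<Sum>j\<in>UNIV. C k j * y k * y j) = 0 \<and> (\<Sum>j\<in>UNIV. C i j * y j) \<noteq> 0}"

text \<open>Equal minimal values make \<open>y\<close> orthogonal to
  \<open>\<theta> - \<eta>\<close>, which is the difference matrix applied to \<open>y\<close>;
  \<open>i\<close> is a coordinate where the two fits differ.\<close>

lemma least_squares_fit_not_unique:
  fixes x :: "'n::finite \<Rightarrow> real ^ 'd"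
  assumes "least_squares_fit x y \<theta>" "least_squares_fit x y \<eta>" "\<theta> \<noteq> \<eta>"
  shows "\<exists>r s i. equivp r \<and> equivp s \<and>
    y \<in> critical_zeros (\<lambda>k j. average_matrix r k j - average_matrix s k j) i"
proof -
  let ?r = "\<lambda>k j. \<theta> $ k = \<theta> $ j" and ?s = "\<lambda>k j. \<eta> $ k = \<eta> $ j"
  have row: "(\<Sum>j\<in>UNIV. (average_matrix ?r k j - average_matrix ?s k j) * y j) = \<theta> $ k - \<eta> $ k" for k
    by (subst (2) least_squares_fit_average[OF assms(1)], subst (2) least_squares_fit_average[OF assms(2)])
      (simp add: left_diff_distrib sum_subtractf)
  have "(\<Sum>k\<in>UNIV. (y k - \<theta> $ k)\<^sup>2) = (\<Sum>k\<in>UNIV. (y k - \<eta> $ k)\<^sup>2)"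
    using assms(1,2) by (auto simp: least_squares_fit_def is_arg_min_def not_less intro: antisym)
  then have "(\<Sum>k\<in>UNIV. y k * (\<theta> $ k - \<eta> $ k)) = 0"
    by (simp add: least_squares_fit_value[OF assms(1)] least_squares_fit_value[OF assms(2)]
        right_diff_distrib sum_subtractf)
  then have "(\<Sum>k\<in>UNIV. \<Sum>j\<in>UNIV. (average_matrix ?r k j - average_matrix ?s k j) * y k * y j) = 0"
    unfolding row[symmetric] by (simp add: sum_distrib_left mult_ac)
  moreover obtain i where "\<theta> $ i \<noteq> \<eta> $ i" using assms(3) by (auto simp: vec_eq_iff)
  ultimately have "y \<in> critical_zeros (\<lambda>k j. average_matrix ?r k j - average_matrix ?s k j) i"
    by (simp add: critical_zeros_def row)
  moreover have "equivp ?r" "equivp ?s"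
    by (auto intro!: equivpI simp: reflp_def symp_def transp_def)
  ultimately show ?thesis by blast
qed

section \<open>Null sets from finite slices\<close>

lemma finite_critical_zeros_slice:
  fixes C :: "'n::finite \<Rightarrow> 'n \<Rightarrow> real"
  assumes sym: "\<And>k j. C k j = C j k"
  shows "finite {t. y(i := t) \<in> critical_zeros C i}"
proof -
  define z where "z = y(i := 0)"
  define b where "b = (\<Sum>j\<in>UNIV. C i j * z j)"
  define c where "c = (\<Sum>k\<in>UNIV. \<Sum>j\<in>UNIV. C k j * z k * z j)"
  have upd: "(y(i := t)) k = z k + t * of_bool (k = i)" for t k
    by (simp add: z_def)
  have row: "(\<Sum>j\<in>UNIV. C k j * (y(i := t)) j) = (\<Sum>j\<in>UNIV. C k j * z j) + t * C k i" for t k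
    unfolding upd distrib_left sum.distrib by (simp add: of_bool_def if_distrib cong: if_cong)
  have form: "(\<Sum>k\<in>UNIV. \<Sum>j\<in>UNIV. C k j * (y(i := t)) k * (y(i := t)) j) = c + t * (2 * b + t * C i i)" for t
  proof -
    have "(\<Sum>k\<in>UNIV. \<Sum>j\<in>UNIV. C k j * (y(i := t)) k * (y(i := t)) j)
        = (\<Sum>k\<in>UNIV. (y(i := t)) k * (\<Sum>j\<in>UNIV. C k j * (y(i := t)) j))"
      by (simp add: sum_distrib_left mult_ac)
    also have "\<dots> = (\<Sum>k\<in>UNIV. (z k + t * of_bool (k = i)) * ((\<Sum>j\<in>UNIV. C k j * z j) + t * C k i))"
      unfolding row unfolding upd ..
    also have "\<dots> = (\<Sum>k\<in>UNIV. z k * (\<Sum>j\<in>UNIV. C k j * z j)) + t * (\<Sum>k\<in>UNIV. C k i * z k)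
        + (\<Sum>k\<in>UNIV. if k = i then t * ((\<Sum>j\<in>UNIV. C k j * z j) + t * C k i) else 0)"
      unfolding sum_distrib_left[of t] sum.distrib[symmetric]
      by (rule sum.cong) (auto simp: algebra_simps)
    \<comment> \<open>Symmetry turns this column sum into the row sum, which yields the linear
      coefficient \<open>2 * b\<close>.\<close>
    also have "(\<Sum>k\<in>UNIV. C k i * z k) = b" unfolding b_def by (simp add: sym[of _ i])
    also have "(\<Sum>k\<in>UNIV. z k * (\<Sum>j\<in>UNIV. C k j * z j)) = c"
      by (simp add: c_def sum_distrib_left mult_ac)
    finally show ?thesis by (simp add: b_def algebra_simps)
  qed
  have eq: "{t. y(i := t) \<in> critical_zeros C i} = {t. poly [:c, 2 * b, C i i:] t = 0 \<and> b + t * C i i \<noteq> 0}"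
    unfolding critical_zeros_def mem_Collect_eq form row by (simp add: b_def)
  show ?thesis
  \<comment> \<open>If both coefficients vanish, so does the derivative for every \<open>t\<close>
    and the slice is empty; otherwise the polynomial is nonzero and has finitely many roots.\<close>
  proof (cases "b = 0 \<and> C i i = 0")
    case True
    then show ?thesis unfolding eq by simp
  next
    case False
    then have "finite {t. poly [:c, 2 * b, C i i:] t = 0}" by (intro poly_roots_finite) auto
    then show ?thesis unfolding eq by (rule finite_subset[rotated]) auto
  qed
qed

text \<open>Tonelli with coordinate \<open>i\<close> integrated first: each inner integral is the
  \<open>N i\<close>-measure of a finite set, which is zero for an atomless law.\<close>

lemma null_set_PiM_finite_slices:
  fixes N :: "'i::finite \<Rightarrow> 'a measure"
  assumes "\<And>i. sigma_finite_measure (N i)"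
    and A: "A \<in> sets (PiM UNIV N)"
    and atomless: "\<And>a. {a} \<in> null_sets (N i)"
    and slice: "\<And>y. finite {t. y(i := t) \<in> A}"
  shows "A \<in> null_sets (PiM UNIV N)"
proof (rule null_setsI[OF _ A])
  interpret product_sigma_finite N using assms(1) by (simp add: product_sigma_finite_def)
  have UNIV: "(UNIV :: 'i set) = insert i (- {i})" by auto
  have "emeasure (PiM UNIV N) A = (\<integral>\<^sup>+ y. indicator A y \<partial>PiM UNIV N)" using A by simp
  also have "\<dots> = (\<integral>\<^sup>+ y. \<integral>\<^sup>+ t. indicator A (y(i := t)) \<partial>N i \<partial>PiM (- {i}) N)"
    using A unfolding UNIV
    by (intro product_nn_integral_insert) (auto simp flip: UNIV)
  also have "\<dots> = (\<integral>\<^sup>+ y. 0 \<partial>PiM (- {i}) N)"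
  proof (rule nn_integral_cong)
    fix y
    have "(\<Union>a\<in>{t. y(i := t) \<in> A}. {a}) \<in> null_sets (N i)"
      using slice by (intro null_sets_UN' atomless) (auto intro: countable_finite)
    then have "{t. y(i := t) \<in> A} \<in> null_sets (N i)" by simp
    then have "(\<integral>\<^sup>+ t. indicator {t. y(i := t) \<in> A} t \<partial>N i) = 0"
      by (subst nn_integral_indicator) auto
    then show "(\<integral>\<^sup>+ t. indicator A (y(i := t)) \<partial>N i) = 0"
      by (simp add: indicator_def)
  qed
  finally show "emeasure (PiM UNIV N) A = 0" by simp
qed

text \<open>Independence makes the joint law of the responses a product, to which the slice
  criterion applies.\<close>

lemma AE_not_critical_zeros:
  fixes Ys :: "'n::finite \<Rightarrow> 'a \<Rightarrow> real"
  assumes "prob_space M"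
    and indep: "prob_space.indep_vars M (\<lambda>_. borel) Ys UNIV"
    and atomless: "\<And>k a. {a} \<in> null_sets (distr M borel (Ys k))"
    and sym: "\<And>k j. C k j = C j k"
  shows "AE \<omega> in M. (\<lambda>k. Ys k \<omega>) \<notin> critical_zeros C i"
proof -
  interpret prob_space M by fact
  define N where "N k = distr M borel (Ys k)" for k
  have rv: "Ys k \<in> borel_measurable M" for k
    using indep by (auto simp: indep_vars_def)
  have distr: "distr M (PiM UNIV (\<lambda>_. borel)) (\<lambda>\<omega> k. Ys k \<omega>) = PiM UNIV N"
    using indep_vars_iff_distr_eq_PiM[where I = UNIV and M' = "\<lambda>_. borel" and X = Ys] indep rv
    by (simp add: N_def[abs_def] restrict_UNIV)
  have sets: "sets (PiM UNIV N) = sets (PiM UNIV (\<lambda>_. borel))"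
    by (intro sets_PiM_cong) (auto simp: N_def)
  have "critical_zeros C i = {y \<in> space (PiM UNIV (\<lambda>_. borel)).
      (\<Sum>k\<in>UNIV. \<Sum>j\<in>UNIV. C k j * y k * y j) = 0 \<and> (\<Sum>j\<in>UNIV. C i j * y j) \<noteq> 0}"
    by (simp add: critical_zeros_def space_PiM)
  also have "\<dots> \<in> sets (PiM UNIV (\<lambda>_. borel))" by measurable
  finally have "critical_zeros C i \<in> sets (PiM UNIV N)" using sets by simp
  then have "critical_zeros C i \<in> null_sets (PiM UNIV N)"
  proof (rule null_set_PiM_finite_slices[where i = i, rotated])
    show "sigma_finite_measure (N k)" for k
      unfolding N_def by (intro prob_space_imp_sigma_finite prob_space_distr rv)
    show "{a} \<in> null_sets (N i)" for a
      unfolding N_def by (rule atomless)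
    show "finite {t. y(i := t) \<in> critical_zeros C i}" for y
      using sym by (rule finite_critical_zeros_slice)
  qed
  then have "AE y in distr M (PiM UNIV (\<lambda>_. borel)) (\<lambda>\<omega> k. Ys k \<omega>). y \<notin> critical_zeros C i"
    unfolding distr by (rule AE_not_in)
  then show ?thesis
    by (rule AE_distrD[rotated]) (intro measurable_PiM_single', use rv in auto)
qed

section \<open>Responses with a density and almost sure uniqueness\<close>

lemma atomless_distributed_lborel:
  fixes Y :: "'a \<Rightarrow> real"
  assumes "distributed M lborel Y f"
  shows "{a} \<in> null_sets (distr M borel Y)"
proof -
  have "distr M borel Y = density lborel f"
    using assms by (simp add: distributed_def cong: distr_cong)
  moreover have "AE x in lborel. x \<in> {a} \<longrightarrow> f x = 0"
    by (rule AE_I'[of "{a}"]) auto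
  ultimately show ?thesis
    using assms by (simp add: null_sets_density_iff distributed_def)
qed

theorem theorem3p3:
  fixes M :: "'a measure"
    and X :: "'a \<Rightarrow> real ^ 'd" and Y \<epsilon> :: "'a \<Rightarrow> real" and \<phi> :: "real ^ 'd \<Rightarrow> real"
    and Xs :: "'n::finite \<Rightarrow> 'a \<Rightarrow> real ^ 'd" and Ys :: "'n \<Rightarrow> 'a \<Rightarrow> real"
  assumes "prob_space M"
    and "regression_model M X Y \<phi> \<epsilon>"
    and "iid_copies M (\<lambda>k \<omega>. (Xs k \<omega>, Ys k \<omega>)) (\<lambda>\<omega>. (X \<omega>, Y \<omega>))"
  shows "(\<forall>\<omega>\<in>space M. \<exists>\<theta>. least_squares_fit (\<lambda>k. Xs k \<omega>) (\<lambda>k. Ys k \<omega>) \<theta>) \<and>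
    ((\<exists>f. distributed M lborel Y f) \<longrightarrow>
       (AE \<omega> in M. \<exists>!\<theta>. least_squares_fit (\<lambda>k. Xs k \<omega>) (\<lambda>k. Ys k \<omega>) \<theta>))"
proof (intro conjI ballI least_squares_fit_exists impI)
  interpret prob_space M by fact
  assume "\<exists>f. distributed M lborel Y f"
  then obtain f where f: "distributed M lborel Y f" ..
  have snd: "snd \<in> borel_measurable (borel :: ((real ^ 'd) \<times> real) measure)"
    by (intro borel_measurable_continuous_onI continuous_intros)
  have indep_pairs: "indep_vars (\<lambda>_. borel) (\<lambda>k \<omega>. (Xs k \<omega>, Ys k \<omega>)) UNIV"
    and pair_distr: "\<And>k. distr M borel (\<lambda>\<omega>. (Xs k \<omega>, Ys k \<omega>)) = distr M borel (\<lambda>\<omega>. (X \<omega>, Y \<omega>))"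
    using assms(3) by (auto simp: iid_copies_def)
  \<comment> \<open>Independence and equality of laws are given for the pairs; \<open>snd\<close>
    transfers both to the responses.\<close>
  have indep: "indep_vars (\<lambda>_. borel) Ys UNIV"
    using indep_vars_compose2[OF indep_pairs, of "\<lambda>_. snd" "\<lambda>_. borel"] snd by simp
  have pair_meas: "(\<lambda>\<omega>. (Xs k \<omega>, Ys k \<omega>)) \<in> borel_measurable M" for k
    using indep_pairs by (auto simp: indep_vars_def)
  have XY_meas: "(\<lambda>\<omega>. (X \<omega>, Y \<omega>)) \<in> borel_measurable M"
    using assms(2) by (auto simp: regression_model_def intro: borel_measurable_Pair)
  have "distr M borel (Ys k) = distr M borel Y" for k
    using arg_cong[OF pair_distr[of k], of "\<lambda>N. distr N borel snd"]
    by (simp add: distr_distr[OF snd pair_meas] distr_distr[OF snd XY_meas] comp_def)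
  then have atomless: "{a} \<in> null_sets (distr M borel (Ys k))" for a k
    using atomless_distributed_lborel[OF f] by simp
  have "AE \<omega> in M. equivp r \<and> equivp s \<longrightarrow> (\<lambda>k. Ys k \<omega>) \<notin>
      critical_zeros (\<lambda>k j. average_matrix r k j - average_matrix s k j) i" for r s i
  proof (cases "equivp r \<and> equivp s")
    case True
    then show ?thesis
      using average_matrix_sym by (auto intro!: AE_not_critical_zeros[OF assms(1) indep atomless] arg_cong2[of _ _ _ _ "(-)"])
  qed auto
  \<comment> \<open>There are finitely many triples \<open>r\<close>, \<open>s\<close>,
    \<open>i\<close>, so one null event covers them all, whatever the random design points
    are.\<close>
  then have "AE \<omega> in M. \<forall>r s i. equivp r \<and> equivp s \<longrightarrow> (\<lambda>k. Ys k \<omega>) \<notin>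
      critical_zeros (\<lambda>k j. average_matrix r k j - average_matrix s k j) i"
    by (intro eventually_all_finite)
  then show "AE \<omega> in M. \<exists>!\<theta>. least_squares_fit (\<lambda>k. Xs k \<omega>) (\<lambda>k. Ys k \<omega>) \<theta>"
  proof eventually_elim
    case (elim \<omega>)
    then show ?case
      using least_squares_fit_exists least_squares_fit_not_unique by metis
  qed
qed

end
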